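(* Let $\mathcal{P}_{\mathrm{CN}(5,2)}$ denote the set of all $\mathcal{P}$-positions of $\mathrm{CN}(5,2)$. Write a position of $\mathrm{CN}(8,3)$, after a suitable rotation and/or reflection, as $$\boldsymbol{p}=(a,\,b+x_1,\,a+x_2,\,b+x_3,\,a+x_4,\,b+x_5,\,a+x_6,\,b+x_7),$$ where $a=\min(p_0,p_2,p_4,p_6)$, $b=\min(p_1,p_3,p_5,p_7)$, $a\le b$, and $x_i\ge 0$. Then, up to rotation and reflection of positions, the set of $\mathcal{P}$-positions of $\mathrm{CN}(8,3)$ is $$\mathcal{P}_{8,3}=\{\boldsymbol{p}\mid x_3=0\ \text{ and }\ \bar{\boldsymbol{p}}=(x_1,x_2,x_4,x_5+x_6,x_7)\in\mathcal{P}_{\mathrm{CN}(5,2)}\}.$$ That is, a position is a $\mathcal{P}$-position of $\mathrm{CN}(8,3)$ if and only if some rotation or reflection (element of the dihedral group of the 8-cycle) of it has the form $(a,\,b+x_1,\,a+x_2,\,b+x_3,\,a+x_4,\,b+x_5,\,a+x_6,\,b+x_7)$, where $a$ is the minimum of its entries with even index, $b$ is the minimum of its entries with odd index, $a\le b$, and $x_i\ge 0$, and satisfies $x_3=0$ and $(x_1,x_2,x_4,x_5+x_6,x_7)\in\mathcal{P}_{\mathrm{CN}(5,2)}$.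
   Context: CircularNim $\mathrm{CN}(n,k)$ is played on $n$ stacks of tokens arranged in a circle. A position is a vector of $n$ non-negative integers (stack heights in cyclic order). In each move a player selects $k$ consecutive stacks (cyclically) and removes at least one token in total from these $k$ stacks (any number of tokens may be removed from each selected stack, including none, as long as at least one token is removed overall). Two players alternate, and the last player to move wins. An $\mathcal{N}$-position is one from which the player about to move can win with optimal play; a $\mathcal{P}$-position is one from which the player about to move loses against optimal play. Positions of CircularNim are considered only up to rotation and reflection. Positions of $\mathrm{CN}(8,3)$ are indexed $\boldsymbol{p}=(p_0,p_1,\ldots,p_7)$. Known fact (recalled from earlier work): a position is a $\mathcal{P}$-position of $\mathrm{CN}(5,2)$ if and only if some rotation or reflection of it has the form $(M,m,c,d,m)$ with $M$ equal to the maximum stack height and $M+m=c+d$. *)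

theory Defs
  imports Main
begin

text \<open>
  A position of CircularNim on \<open>n\<close> stacks is the list of its \<open>n\<close> stack heights in cyclic order.
  The player to move chooses the \<open>k\<close> cyclically consecutive stacks starting at some stack \<open>s\<close>,
  may lower each of them, and must remove at least one token in total (\<open>q \<noteq> p\<close>).
\<close>

definition cn_move :: "nat \<Rightarrow> nat \<Rightarrow> nat list \<Rightarrow> nat list \<Rightarrow> bool" where
  "cn_move n k p q \<longleftrightarrow>
     length p = n \<and> length q = n \<and> q \<noteq> p \<and>
     (\<exists>s<n. \<forall>i<n. q ! i \<le> p ! i \<and>
        (i \<notin> {(s + j) mod n | j. j < k} \<longrightarrow> q ! i = p ! i))"

text \<open>
  The last player to move wins: a position without moves is lost for the player about to move,
  which is the vacuous instance of rule \<open>P_posI\<close>.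
\<close>

inductive N_pos :: "nat \<Rightarrow> nat \<Rightarrow> nat list \<Rightarrow> bool"
  and P_pos :: "nat \<Rightarrow> nat \<Rightarrow> nat list \<Rightarrow> bool"
  for n k :: nat
where
  N_posI: "cn_move n k p q \<Longrightarrow> P_pos n k q \<Longrightarrow> N_pos n k p"
| P_posI: "length p = n \<Longrightarrow> (\<forall>q. cn_move n k p q \<longrightarrow> N_pos n k q) \<Longrightarrow> P_pos n k p"

definition P_positions :: "nat \<Rightarrow> nat \<Rightarrow> nat list set" where
  "P_positions n k = {p. P_pos n k p}"

definition dihedral_images :: "'a list \<Rightarrow> 'a list set" where
  "dihedral_images p = {rotate r p | r. True} \<union> {rotate r (rev p) | r. True}"

definition P83 :: "nat list set" where
  "P83 = {p. \<exists>a b x1 x2 x3 x4 x5 x6 x7.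
     p = [a, b + x1, a + x2, b + x3, a + x4, b + x5, a + x6, b + x7] \<and>
     a = Min {p ! 0, p ! 2, p ! 4, p ! 6} \<and>
     b = Min {p ! 1, p ! 3, p ! 5, p ! 7} \<and>
     a \<le> b \<and>
     x3 = 0 \<and>
     [x1, x2, x4, x5 + x6, x7] \<in> P_positions 5 2}"

end

theory Submission
  imports Defs
begin

text \<open>
  The proof exhibits an explicit set of positions, called cold below, from which no move stays in the
  set and into which every other position can move; such a set is the set of P-positions
  (\<open>P_positions_eqI\<close>). It is applied first to CN(5,2), where the set consists of the circles
  \<open>(M, m, c, d, m)\<close> with peak \<open>M\<close> and \<open>M + m = c + d\<close>, and then to CN(8,3).

  In CN(8,3) split the stacks into two classes by the parity of their index. A position is anchored
  when stack 0 is lowest in its class, stack 3 is lowest in its class, and the heights above these two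
  minima, read as the circle \<open>(x1, x2, x4, x5 + x6, x7)\<close>, are a P-position of CN(5,2). Stacks 0 and 3
  have no height to spare, and three consecutive stacks then meet at most two neighbouring heaps of
  the circle. So, as long as both minima are kept, CN(8,3) is played on the circle as CN(5,2). A cold
  position is a rotation of an anchored one. The reflection that maps index \<open>i\<close> to \<open>3 - i\<close>
  exchanges the two classes and preserves being anchored. Hence the two minima can always be put in
  the order \<open>a \<le> b\<close>, and cold positions are exactly the dihedral images of \<open>P83\<close>.

  For the move analysis three observations go beyond the correspondence with CN(5,2).

  \<^item> A position may have several pairs of lowest stacks at distance three. Any of them can serve as the
    anchor (\<open>cold_lowest_anchored\<close>), because a further lowest stack makes a heap of the circle empty
    or regroups the same heaps, and balance of a circle with an empty heap is a simple equation.

  \<^item> A move that lowers the minimum of one class by \<open>d\<close> raises the heights above it: two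
    neighbouring heaps of the circle grow by \<open>d\<close>, the next one by at most \<open>d\<close>, and the other two
    do not grow. This destroys balance (\<open>balanced_raise\<close>, \<open>cold_no_new_minimum\<close>).

  \<^item> If no lowest stacks of different classes are at distance three, some are adjacent, and six
    explicit moves cover all cases (\<open>adjacent_absorb\<close>).
\<close>

section \<open>Recognising the set of P-positions\<close>

lemma cn_move_sum_less:
  assumes "cn_move n k p q"
  shows "sum_list q < sum_list p"
proof -
  have len: "length p = n" "length q = n" and ne: "q \<noteq> p"
    and le: "\<And>i. i < n \<Longrightarrow> q ! i \<le> p ! i"
    using assms by (auto simp: cn_move_def)
  obtain i where "i < n" "q ! i \<noteq> p ! i"
    using ne len by (metis nth_equalityI)
  then have "(\<Sum>i<n. q ! i) < (\<Sum>i<n. p ! i)"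
    using le by (intro sum_strict_mono_ex1) (auto simp: order_less_le)
  then show ?thesis
    by (simp add: sum_list_sum_nth len atLeast0LessThan)
qed

lemma N_P_exclusive:
  shows "N_pos n k p \<Longrightarrow> \<not> P_pos n k p" and "P_pos n k p \<Longrightarrow> \<not> N_pos n k p"
proof (induction rule: N_pos_P_pos.inducts)
  case (N_posI p q)
  then show ?case by (metis P_pos.cases)
next
  case (P_posI p)
  then show ?case by (metis N_pos.cases)
qed

text \<open>
  This is the standard kernel argument: by induction on the number of tokens, every move from a
  member of \<open>T\<close> lets the opponent win, and from any other position some move makes him lose.
\<close>

lemma P_positions_eqI:
  assumes len: "\<And>p. p \<in> T \<Longrightarrow> length p = n"
    and stable: "\<And>p q. p \<in> T \<Longrightarrow> q \<in> T \<Longrightarrow> \<not> cn_move n k p q"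
    and absorb: "\<And>p. length p = n \<Longrightarrow> p \<notin> T \<Longrightarrow> \<exists>q\<in>T. cn_move n k p q"
  shows "P_positions n k = T"
proof -
  have main: "(p \<in> T \<longrightarrow> P_pos n k p) \<and> (p \<notin> T \<longrightarrow> N_pos n k p)" if "length p = n" for p
    using that
  proof (induction "sum_list p" arbitrary: p rule: less_induct)
    case less
    have IH: "(q \<in> T \<longrightarrow> P_pos n k q) \<and> (q \<notin> T \<longrightarrow> N_pos n k q)" if "cn_move n k p q" for q
      using less.hyps[OF cn_move_sum_less[OF that]] that by (simp add: cn_move_def)
    show ?case
    proof (intro conjI impI)
      assume "p \<in> T"
      with stable IH less.prems show "P_pos n k p" by (blast intro: P_posI)
    next
      assume "p \<notin> T"
      with absorb IH less.prems show "N_pos n k p" by (blast intro: N_posI)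
    qed
  qed
  have "length p = n" if "P_pos n k p" for p
    using that by (auto elim: P_pos.cases)
  with main len show ?thesis
    by (auto simp: P_positions_def dest: N_P_exclusive)
qed

section \<open>Rotations and reflections\<close>

lemma unrotate:
  assumes "length p = n" "0 < n"
  shows "rotate (n - r mod n) (rotate r p) = p"
proof -
  have "(n - r mod n + r) mod n = (n - r mod n + r mod n) mod n"
    by (simp add: mod_add_right_eq)
  also have "\<dots> = 0"
    using assms(2) by (simp add: less_imp_le)
  finally show ?thesis
    using assms by (simp add: rotate_rotate rotate_id)
qed

lemma ex_rotate_less:
  assumes "length p = n" "0 < n"
  shows "(\<exists>r. P (rotate r p)) \<longleftrightarrow> (\<exists>r<n. P (rotate r p))"
proof
  assume "\<exists>r. P (rotate r p)"
  then obtain r where "P (rotate r p)" ..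
  then have "P (rotate (r mod n) p)"
    using rotate_conv_mod[of r p] assms(1) by simp
  moreover have "r mod n < n" using assms(2) by simp
  ultimately show "\<exists>r<n. P (rotate r p)" by blast
qed blast

lemma rev_rotate:
  assumes "length p = n" "0 < n"
  shows "rev (rotate r p) = rotate (n - r mod n) (rev p)"
proof -
  have "rotate r (rev (rotate r p)) = rev p"
    using rotate_rev[of r "rotate r p"] unrotate[OF assms, of r] assms(1) by simp
  then show ?thesis
    using unrotate[of "rev (rotate r p)" n r] assms by simp
qed

text \<open>
  A window starting at \<open>s\<close> becomes, after rotation by \<open>r\<close>, the window starting at the residue of
  \<open>s - r\<close>, which is \<open>t\<close> in the proof.
\<close>

lemma cn_move_rotate:
  assumes "cn_move n k p q"
  shows "cn_move n k (rotate r p) (rotate r q)"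
proof -
  obtain s where s: "s < n" and le: "\<And>i. i < n \<Longrightarrow> q ! i \<le> p ! i"
    and out: "\<And>i. i < n \<Longrightarrow> i \<notin> {(s + j) mod n | j. j < k} \<Longrightarrow> q ! i = p ! i"
    and len: "length p = n" "length q = n" and ne: "q \<noteq> p"
    using assms by (auto simp: cn_move_def)
  have n: "0 < n" using s by simp
  define t where "t = (s + (n - r mod n)) mod n"
  have t: "(t + r) mod n = s"
  proof -
    have "(t + r) mod n = (s + ((n - r mod n) + r mod n)) mod n"
      unfolding t_def by (metis add.assoc mod_add_left_eq mod_add_right_eq)
    also have "(n - r mod n) + r mod n = n"
      using n by (simp add: less_imp_le)
    finally show ?thesis using s by simp
  qed
  have "rotate r q ! i = rotate r p ! i"
    if i: "i < n" and notin: "i \<notin> {(t + j) mod n | j. j < k}" for i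
  proof -
    have "(r + i) mod n \<notin> {(s + j) mod n | j. j < k}"
    proof clarify
      fix j assume eq: "(r + i) mod n = (s + j) mod n" and "j < k"
      have "(s + j) mod n = (r + (t + j)) mod n"
        unfolding t[symmetric] by (simp add: mod_simps ac_simps)
      with eq have "(r + i) mod n = (r + (t + j)) mod n"
        by (rule trans)
      then have "i mod n = (t + j) mod n"
        unfolding nat_mod_eq_iff by (simp add: add.assoc)
      with i notin \<open>j < k\<close> show False by auto
    qed
    with out n len show ?thesis by (simp add: nth_rotate i)
  qed
  moreover have "rotate r q ! i \<le> rotate r p ! i" if "i < n" for i
    using that n le len by (simp add: nth_rotate)
  moreover have "rotate r q \<noteq> rotate r p"
    using ne unrotate[OF len(1) n] unrotate[OF len(2) n] by metis
  moreover have "t < n" using n by (simp add: t_def)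
  ultimately show ?thesis
    using len unfolding cn_move_def by auto
qed

section \<open>Moves in coordinates\<close>

lemma window2: "{(s + j) mod n | j. j < (2::nat)} = {s mod n, (s + 1) mod n}"
proof -
  have "{(s + j) mod n | j. j < (2::nat)} = (\<lambda>j. (s + j) mod n) ` {..<2}" by auto
  also have "{..<2::nat} = {0, 1}" by auto
  finally show ?thesis by simp
qed

lemma window3: "{(s + j) mod n | j. j < (3::nat)} = {s mod n, (s + 1) mod n, (s + 2) mod n}"
proof -
  have "{(s + j) mod n | j. j < (3::nat)} = (\<lambda>j. (s + j) mod n) ` {..<3}" by auto
  also have "{..<3::nat} = {0, 1, 2}" by auto
  finally show ?thesis by simp
qed

text \<open>
  Separating the monotonicity from the choice of the window keeps the expansion over all stacks
  short: the inequalities occur once and not once per window.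
\<close>

lemma cn_move_iff:
  "cn_move n k p q \<longleftrightarrow>
     length p = n \<and> length q = n \<and> q \<noteq> p \<and> (\<forall>i<n. q ! i \<le> p ! i) \<and>
     (\<exists>s<n. \<forall>i<n. i \<notin> {(s + j) mod n | j. j < k} \<longrightarrow> q ! i = p ! i)"
  unfolding cn_move_def by blast

lemma all_less_5: "(\<forall>i<5. P i) \<longleftrightarrow> P 0 \<and> P 1 \<and> P 2 \<and> P 3 \<and> P (4::nat)"
  by (simp add: eval_nat_numeral All_less_Suc conj_ac)

lemma ex_less_5: "(\<exists>i<5. P i) \<longleftrightarrow> P 0 \<or> P 1 \<or> P 2 \<or> P 3 \<or> P (4::nat)"
  by (simp add: eval_nat_numeral Ex_less_Suc disj_ac)

lemma all_less_8: "(\<forall>i<8. P i) \<longleftrightarrow> P 0 \<and> P 1 \<and> P 2 \<and> P 3 \<and> P 4 \<and> P 5 \<and> P 6 \<and> P (7::nat)"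
  by (simp add: eval_nat_numeral All_less_Suc conj_ac)

lemma ex_less_8: "(\<exists>i<8. P i) \<longleftrightarrow> P 0 \<or> P 1 \<or> P 2 \<or> P 3 \<or> P 4 \<or> P 5 \<or> P 6 \<or> P (7::nat)"
  by (simp add: eval_nat_numeral Ex_less_Suc disj_ac)

lemma cn_move_5_2:
  "cn_move 5 2 [y0, y1, y2, y3, y4] [z0, z1, z2, z3, z4] \<longleftrightarrow>
     [z0, z1, z2, z3, z4] \<noteq> [y0, y1, y2, y3, y4] \<and>
     z0 \<le> y0 \<and> z1 \<le> y1 \<and> z2 \<le> y2 \<and> z3 \<le> y3 \<and> z4 \<le> y4 \<and>
     (z2 = y2 \<and> z3 = y3 \<and> z4 = y4 \<or> z0 = y0 \<and> z3 = y3 \<and> z4 = y4 \<or>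
      z0 = y0 \<and> z1 = y1 \<and> z4 = y4 \<or> z0 = y0 \<and> z1 = y1 \<and> z2 = y2 \<or>
      z1 = y1 \<and> z2 = y2 \<and> z3 = y3)"
  unfolding cn_move_iff window2 ex_less_5 all_less_5
  by (simp del: list.inject add: conj_assoc disj_assoc)

lemma cn_move_8_3:
  "cn_move 8 3 [p0, p1, p2, p3, p4, p5, p6, p7] [q0, q1, q2, q3, q4, q5, q6, q7] \<longleftrightarrow>
     [q0, q1, q2, q3, q4, q5, q6, q7] \<noteq> [p0, p1, p2, p3, p4, p5, p6, p7] \<and>
     q0 \<le> p0 \<and> q1 \<le> p1 \<and> q2 \<le> p2 \<and> q3 \<le> p3 \<and> q4 \<le> p4 \<and> q5 \<le> p5 \<and> q6 \<le> p6 \<and> q7 \<le> p7 \<and>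
     (q3 = p3 \<and> q4 = p4 \<and> q5 = p5 \<and> q6 = p6 \<and> q7 = p7 \<or>
      q0 = p0 \<and> q4 = p4 \<and> q5 = p5 \<and> q6 = p6 \<and> q7 = p7 \<or>
      q0 = p0 \<and> q1 = p1 \<and> q5 = p5 \<and> q6 = p6 \<and> q7 = p7 \<or>
      q0 = p0 \<and> q1 = p1 \<and> q2 = p2 \<and> q6 = p6 \<and> q7 = p7 \<or>
      q0 = p0 \<and> q1 = p1 \<and> q2 = p2 \<and> q3 = p3 \<and> q7 = p7 \<or>
      q0 = p0 \<and> q1 = p1 \<and> q2 = p2 \<and> q3 = p3 \<and> q4 = p4 \<or>
      q1 = p1 \<and> q2 = p2 \<and> q3 = p3 \<and> q4 = p4 \<and> q5 = p5 \<or>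
      q2 = p2 \<and> q3 = p3 \<and> q4 = p4 \<and> q5 = p5 \<and> q6 = p6)"
  unfolding cn_move_iff window3 ex_less_8 all_less_8
  by (simp del: list.inject add: conj_assoc disj_assoc)

section \<open>The P-positions of CN(5,2)\<close>

text \<open>
  The circle \<open>(M, l, c, d, r)\<close> has the shape \<open>(M, m, c, d, m)\<close> of the known P-positions of CN(5,2).
  The bounds on \<open>c\<close> and \<open>d\<close> together with the equation give \<open>l \<le> c\<close>, \<open>l \<le> d\<close> and
  \<open>l \<le> M\<close>; so \<open>M\<close> is a maximum and \<open>l = r\<close> a minimum of the circle.
\<close>

definition peak :: "nat \<Rightarrow> nat \<Rightarrow> nat \<Rightarrow> nat \<Rightarrow> nat \<Rightarrow> bool" where
  "peak M l c d r \<longleftrightarrow> l = r \<and> c \<le> M \<and> d \<le> M \<and> M + l = c + d"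

definition balanced :: "nat \<Rightarrow> nat \<Rightarrow> nat \<Rightarrow> nat \<Rightarrow> nat \<Rightarrow> bool" where
  "balanced y0 y1 y2 y3 y4 \<longleftrightarrow>
     peak y0 y1 y2 y3 y4 \<or> peak y1 y2 y3 y4 y0 \<or> peak y2 y3 y4 y0 y1 \<or>
     peak y3 y4 y0 y1 y2 \<or> peak y4 y0 y1 y2 y3"

lemma balanced_rotate_iff: "balanced y0 y1 y2 y3 y4 \<longleftrightarrow> balanced y1 y2 y3 y4 y0"
  unfolding balanced_def by blast

lemma balanced_rotate: "balanced y0 y1 y2 y3 y4 \<Longrightarrow> balanced y1 y2 y3 y4 y0"
  using balanced_rotate_iff by blast

lemma balanced_reflect: "balanced y0 y1 y2 y3 y4 \<Longrightarrow> balanced y4 y3 y2 y1 y0"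
proof -
  have "peak M l c d r \<Longrightarrow> peak M r d c l" for M l c d r
    by (simp add: peak_def)
  then show "balanced y0 y1 y2 y3 y4 \<Longrightarrow> balanced y4 y3 y2 y1 y0"
    unfolding balanced_def by blast
qed

text \<open>
  Let \<open>T = M + l\<close>. It is the largest sum of two neighbours and is attained by the pairs
  \<open>(M, l)\<close>, \<open>(r, M)\<close> and \<open>(c, d)\<close>, and the total is \<open>2 T + l\<close>. Every window of two heaps misses one of
  the three pairs, so a move keeps \<open>T\<close>. If the result were balanced, its smaller total would make
  the two neighbours of its peak lower than \<open>l\<close>, hence lower than before. These neighbours are not
  adjacent to each other, but a move lowers only adjacent heaps. The proof leaves this to linear
  arithmetic, once for each window and each position of the new peak.
\<close>

lemma peak_stable:
  assumes "peak M l c d r" "balanced z0 z1 z2 z3 z4"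
  shows "\<not> cn_move 5 2 [M, l, c, d, r] [z0, z1, z2, z3, z4]"
proof
  assume mv: "cn_move 5 2 [M, l, c, d, r] [z0, z1, z2, z3, z4]"
  have less: "z0 + z1 + z2 + z3 + z4 < M + l + c + d + r"
    using cn_move_sum_less[OF mv] by simp
  from assms(2) mv[unfolded cn_move_5_2, THEN conjunct2] less assms(1) show False
    unfolding balanced_def peak_def
    by (elim conjE disjE; linarith)
qed

lemma balanced_stable:
  assumes "balanced y0 y1 y2 y3 y4" "balanced z0 z1 z2 z3 z4"
  shows "\<not> cn_move 5 2 [y0, y1, y2, y3, y4] [z0, z1, z2, z3, z4]"
proof
  assume mv: "cn_move 5 2 [y0, y1, y2, y3, y4] [z0, z1, z2, z3, z4]"
  have rot: "cn_move 5 2 [y1, y2, y3, y4, y0] [z1, z2, z3, z4, z0]"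
    if "cn_move 5 2 [y0, y1, y2, y3, y4] [z0, z1, z2, z3, z4]"
    for y0 y1 y2 y3 y4 z0 z1 z2 z3 z4 :: nat
    using cn_move_rotate[OF that, of 1] by simp
  note m0 = mv and b0 = assms(2)
  note m1 = rot[OF m0] and b1 = balanced_rotate[OF b0]
  note m2 = rot[OF m1] and b2 = balanced_rotate[OF b1]
  note m3 = rot[OF m2] and b3 = balanced_rotate[OF b2]
  note m4 = rot[OF m3] and b4 = balanced_rotate[OF b3]
  consider "peak y0 y1 y2 y3 y4" | "peak y1 y2 y3 y4 y0" | "peak y2 y3 y4 y0 y1"
    | "peak y3 y4 y0 y1 y2" | "peak y4 y0 y1 y2 y3"
    using assms(1) unfolding balanced_def by blast
  then show False
  proof cases
    case 1 then show ?thesis using peak_stable[OF _ b0] m0 by simp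
  next
    case 2 then show ?thesis using peak_stable[OF _ b1] m1 by simp
  next
    case 3 then show ?thesis using peak_stable[OF _ b2] m2 by simp
  next
    case 4 then show ?thesis using peak_stable[OF _ b3] m3 by simp
  next
    case 5 then show ?thesis using peak_stable[OF _ b4] m4 by simp
  qed
qed

text \<open>
  Lowering nothing is allowed here. This makes it possible to argue up to rotation and reflection
  without carrying along the assumption that the circle is not balanced.
\<close>

definition settles2 :: "nat \<Rightarrow> nat \<Rightarrow> nat \<Rightarrow> nat \<Rightarrow> nat \<Rightarrow> bool" where
  "settles2 y0 y1 y2 y3 y4 \<longleftrightarrow> (\<exists>z0\<le>y0. \<exists>z1\<le>y1. balanced z0 z1 y2 y3 y4)"

definition settles :: "nat \<Rightarrow> nat \<Rightarrow> nat \<Rightarrow> nat \<Rightarrow> nat \<Rightarrow> bool" where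
  "settles y0 y1 y2 y3 y4 \<longleftrightarrow>
     settles2 y0 y1 y2 y3 y4 \<or> settles2 y1 y2 y3 y4 y0 \<or> settles2 y2 y3 y4 y0 y1 \<or>
     settles2 y3 y4 y0 y1 y2 \<or> settles2 y4 y0 y1 y2 y3"

lemma settles_rotate: "settles y1 y2 y3 y4 y0 \<Longrightarrow> settles y0 y1 y2 y3 y4"
  unfolding settles_def by blast

lemma settles_reflect: "settles y4 y3 y2 y1 y0 \<Longrightarrow> settles y0 y1 y2 y3 y4"
proof -
  have "settles2 y1 y0 y4 y3 y2" if s: "settles2 y0 y1 y2 y3 y4" for y0 y1 y2 y3 y4
  proof -
    obtain z0 z1 where "z0 \<le> y0" "z1 \<le> y1" "balanced z0 z1 y2 y3 y4"
      using s by (auto simp: settles2_def)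
    moreover from this(3) have "balanced z1 z0 y4 y3 y2"
      by (rule balanced_rotate[OF balanced_rotate[OF balanced_rotate[OF balanced_reflect]]])
    ultimately show ?thesis by (auto simp: settles2_def)
  qed
  then show "settles y4 y3 y2 y1 y0 \<Longrightarrow> settles y0 y1 y2 y3 y4"
    unfolding settles_def by blast
qed

text \<open>
  If \<open>b + c\<close> is large, \<open>M\<close> stays the peak: its larger neighbour drops to the smaller one and
  \<open>b\<close> or \<open>c\<close> drops next to it. If \<open>b + c\<close> is small and the smaller neighbour of \<open>M\<close> is at most
  \<open>b\<close>, then \<open>M\<close> drops until it balances \<open>b + c\<close>. Otherwise \<open>b\<close> is a minimum and remains as one
  neighbour of the new peak, which is \<open>c\<close> or the possibly lowered \<open>a\<close>; one of \<open>d\<close> and \<open>M\<close>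
  drops to \<open>b\<close> to be the other neighbour.
\<close>

lemma settles_from_max:
  assumes max: "a \<le> M" "b \<le> M" "c \<le> M" "d \<le> M" and "b \<le> c"
  shows "settles M a b c d"
proof -
  have settlesI: "settles M a b c d"
    if "settles2 M a b c d \<or> settles2 a b c d M \<or> settles2 c d M a b \<or> settles2 d M a b c"
    using that unfolding settles_def by blast
  (* The digits name the two heaps that are lowered, counted from M = 0. *)
  have s01: "settles M a b c d" if "balanced z0 z1 b c d" "z0 \<le> M" "z1 \<le> a" for z0 z1
    by (rule settlesI) (use that in \<open>auto simp: settles2_def\<close>)
  have s12: "settles M a b c d" if "balanced M z1 z2 c d" "z1 \<le> a" "z2 \<le> b" for z1 z2
    by (rule settlesI)
      (use balanced_rotate[OF that(1)] that(2,3) in \<open>auto simp: settles2_def\<close>)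
  have s34: "settles M a b c d" if "balanced M a b z3 z4" "z3 \<le> c" "z4 \<le> d" for z3 z4
    by (rule settlesI)
      (use balanced_rotate[OF balanced_rotate[OF balanced_rotate[OF that(1)]]] that(2,3)
        in \<open>auto simp: settles2_def\<close>)
  have s40: "settles M a b c d" if "balanced z0 a b c z4" "z4 \<le> d" "z0 \<le> M" for z0 z4
    by (rule settlesI)
      (use balanced_rotate[OF balanced_rotate[OF balanced_rotate[OF balanced_rotate[OF that(1)]]]]
        that(2,3) in \<open>auto simp: settles2_def\<close>)
  have pk: "balanced y0 y1 y2 y3 y4"
    if "peak y0 y1 y2 y3 y4 \<or> peak y1 y2 y3 y4 y0 \<or> peak y3 y4 y0 y1 y2" for y0 y1 y2 y3 y4
    using that unfolding balanced_def by blast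
  show ?thesis
  proof (cases "M + min a d \<le> b + c")
    case True
    show ?thesis
    proof (cases "d \<le> a")
      case d: True
      show ?thesis using True d max
        by (intro s12[of d "M + d - c"] pk) (auto simp: peak_def)
    next
      case d: False
      show ?thesis using True d max
        by (intro s34[of "M + a - b" a] pk) (auto simp: peak_def)
    qed
  next
    case False
    show ?thesis
    proof (cases "min a d \<le> b")
      case low: True
      show ?thesis
      proof (cases "a \<le> d")
        case a: True
        show ?thesis using False low a assms
          by (intro s40[of "b + c - a" a] pk) (auto simp: peak_def)
      next
        case a: False
        show ?thesis using False low a assms
          by (intro s01[of "b + c - d" d] pk) (auto simp: peak_def)
      qed
    next
      case b: False
      then have b: "b < a" "b < d" by simp_all
      consider "a \<le> c" | "c < a" "a + b \<le> c + d" | "c < a" "c + d < a + b"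
        by linarith
      then show ?thesis
      proof cases
        case 1
        then show ?thesis using False b assms
          by (intro s40[of "b + c - a" b] pk) (auto simp: peak_def)
      next
        case 2
        then show ?thesis using b assms
          by (intro s40[of b "a + b - c"] pk) (auto simp: peak_def)
      next
        case 3
        then show ?thesis using b assms
          by (intro s01[of b "c + d - b"] pk) (auto simp: peak_def)
      qed
    qed
  qed
qed

lemma settles_always: "settles y0 y1 y2 y3 y4"
proof -
  have from_max: "settles M a b c d" if "a \<le> M" "b \<le> M" "c \<le> M" "d \<le> M" for M a b c d
  proof (cases "b \<le> c")
    case True
    with that show ?thesis by (rule settles_from_max)
  next
    case False
    with that have "settles M d c b a" by (intro settles_from_max) auto
    then show ?thesis by (rule settles_rotate[OF settles_reflect])
  qed
  define m where "m = Max {y0, y1, y2, y3, y4}"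
  have le: "y0 \<le> m" "y1 \<le> m" "y2 \<le> m" "y3 \<le> m" "y4 \<le> m"
    unfolding m_def by (rule Max_ge; simp)+
  have "m \<in> {y0, y1, y2, y3, y4}"
    unfolding m_def by (rule Max_in) simp_all
  then consider "m = y0" | "m = y1" | "m = y2" | "m = y3" | "m = y4"
    by blast
  then show ?thesis
  proof cases
    case 1
    show ?thesis
      by (rule from_max[OF le(2,3,4,5)[unfolded 1]])
  next
    case 2
    show ?thesis
      by (rule settles_rotate[OF from_max[OF le(3,4,5,1)[unfolded 2]]])
  next
    case 3
    show ?thesis
      by (rule settles_rotate[OF settles_rotate[OF from_max[OF le(4,5,1,2)[unfolded 3]]]])
  next
    case 4
    show ?thesis
      by (rule settles_rotate[OF settles_rotate[OF settles_rotate[OF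
            from_max[OF le(5,1,2,3)[unfolded 4]]]]])
  next
    case 5
    show ?thesis
      by (rule settles_rotate[OF settles_rotate[OF settles_rotate[OF settles_rotate[OF
            from_max[OF le(1,2,3,4)[unfolded 5]]]]]])
  qed
qed

lemma balanced_absorb:
  assumes "\<not> balanced y0 y1 y2 y3 y4"
  obtains z0 z1 z2 z3 z4 where "balanced z0 z1 z2 z3 z4"
    "cn_move 5 2 [y0, y1, y2, y3, y4] [z0, z1, z2, z3, z4]"
proof -
  note rot1 = balanced_rotate[OF balanced_rotate[OF balanced_rotate[OF balanced_rotate]]]
    and rot2 = balanced_rotate[OF balanced_rotate[OF balanced_rotate]]
    and rot3 = balanced_rotate[OF balanced_rotate]
  have "\<exists>z0 z1 z2 z3 z4. balanced z0 z1 z2 z3 z4 \<and>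
     z0 \<le> y0 \<and> z1 \<le> y1 \<and> z2 \<le> y2 \<and> z3 \<le> y3 \<and> z4 \<le> y4 \<and>
     (z2 = y2 \<and> z3 = y3 \<and> z4 = y4 \<or> z0 = y0 \<and> z3 = y3 \<and> z4 = y4 \<or>
      z0 = y0 \<and> z1 = y1 \<and> z4 = y4 \<or> z0 = y0 \<and> z1 = y1 \<and> z2 = y2 \<or>
      z1 = y1 \<and> z2 = y2 \<and> z3 = y3)"
    using settles_always[of y0 y1 y2 y3 y4] unfolding settles_def settles2_def
    apply (elim disjE exE conjE)
    subgoal for z0 z1 by blast
    subgoal for z1 z2 by (blast dest: rot1)
    subgoal for z2 z3 by (blast dest: rot2)
    subgoal for z3 z4 by (blast dest: rot3)
    subgoal for z4 z0 by (blast dest: balanced_rotate)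
    done
  then show thesis
    using assms that unfolding cn_move_5_2 by blast
qed

lemma P_positions_5_2: "[y0, y1, y2, y3, y4] \<in> P_positions 5 2 \<longleftrightarrow> balanced y0 y1 y2 y3 y4"
proof -
  have len5: "\<exists>y0 y1 y2 y3 y4. p = [y0, y1, y2, y3, y4]" if "length p = 5" for p :: "nat list"
    using that by (auto simp: length_Suc_conv eval_nat_numeral)
  have "P_positions 5 2 = {[y0, y1, y2, y3, y4] | y0 y1 y2 y3 y4. balanced y0 y1 y2 y3 y4}"
    (is "_ = ?T")
  proof (rule P_positions_eqI)
    show "length p = 5" if "p \<in> ?T" for p using that by auto
    show "\<not> cn_move 5 2 p q" if "p \<in> ?T" "q \<in> ?T" for p q
      using that balanced_stable by blast
    show "\<exists>q\<in>?T. cn_move 5 2 p q" if len: "length p = 5" and p: "p \<notin> ?T" for p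
    proof -
      obtain y0 y1 y2 y3 y4 where y: "p = [y0, y1, y2, y3, y4]"
        using len5[OF len] by blast
      with p have "\<not> balanced y0 y1 y2 y3 y4" by blast
      then obtain z0 z1 z2 z3 z4 where "balanced z0 z1 z2 z3 z4"
        "cn_move 5 2 p [z0, z1, z2, z3, z4]"
        unfolding y by (rule balanced_absorb)
      then show ?thesis by blast
    qed
  qed
  then show ?thesis by auto
qed

section \<open>Balanced circles with an empty heap or with raised heaps\<close>

text \<open>
  The peak can be chosen next to the empty heap. Its neighbours have equal height, so the other one
  is empty too, and the peak equals the sum of the remaining two heaps.
\<close>

lemma balanced_zero:
  "balanced 0 y1 y2 y3 y4 \<longleftrightarrow> y2 = 0 \<and> y1 = y3 + y4 \<or> y3 = 0 \<and> y4 = y1 + y2"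
  (is "?L \<longleftrightarrow> ?R")
proof
  assume ?L
  then show ?R
  unfolding balanced_def peak_def by (elim disjE; elim conjE; simp)
next
  assume ?R
  then have "peak y1 y2 y3 y4 0 \<or> peak y4 0 y1 y2 y3"
    unfolding peak_def by (elim disjE) simp_all
  then show ?L
    unfolding balanced_def by blast
qed

lemma balanced_zeros:
  "balanced 0 y1 y2 y3 y4 \<longleftrightarrow> y2 = 0 \<and> y1 = y3 + y4 \<or> y3 = 0 \<and> y4 = y1 + y2"
  "balanced y4 0 y1 y2 y3 \<longleftrightarrow> y2 = 0 \<and> y1 = y3 + y4 \<or> y3 = 0 \<and> y4 = y1 + y2"
  "balanced y3 y4 0 y1 y2 \<longleftrightarrow> y2 = 0 \<and> y1 = y3 + y4 \<or> y3 = 0 \<and> y4 = y1 + y2"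
  "balanced y2 y3 y4 0 y1 \<longleftrightarrow> y2 = 0 \<and> y1 = y3 + y4 \<or> y3 = 0 \<and> y4 = y1 + y2"
  "balanced y1 y2 y3 y4 0 \<longleftrightarrow> y2 = 0 \<and> y1 = y3 + y4 \<or> y3 = 0 \<and> y4 = y1 + y2"
proof -
  note r = balanced_rotate_iff and z = balanced_zero
  show "balanced 0 y1 y2 y3 y4 \<longleftrightarrow> y2 = 0 \<and> y1 = y3 + y4 \<or> y3 = 0 \<and> y4 = y1 + y2"
    by (rule z)
  show "balanced y4 0 y1 y2 y3 \<longleftrightarrow> y2 = 0 \<and> y1 = y3 + y4 \<or> y3 = 0 \<and> y4 = y1 + y2"
    by (rule trans[OF r z])
  show "balanced y3 y4 0 y1 y2 \<longleftrightarrow> y2 = 0 \<and> y1 = y3 + y4 \<or> y3 = 0 \<and> y4 = y1 + y2"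
    by (rule trans[OF r trans[OF r z]])
  show "balanced y2 y3 y4 0 y1 \<longleftrightarrow> y2 = 0 \<and> y1 = y3 + y4 \<or> y3 = 0 \<and> y4 = y1 + y2"
    by (rule trans[OF r trans[OF r trans[OF r z]]])
  show "balanced y1 y2 y3 y4 0 \<longleftrightarrow> y2 = 0 \<and> y1 = y3 + y4 \<or> y3 = 0 \<and> y4 = y1 + y2"
    by (rule trans[OF r trans[OF r trans[OF r trans[OF r z]]]])
qed

text \<open>
  In a balanced circle three of the five pairs of neighbours attain the largest sum of two
  neighbours. At least one such pair of the new circle contains \<open>z0\<close> or \<open>z4\<close>, so that the largest
  sum grows by at most \<open>d\<close>, whereas some pair containing \<open>z2\<close> grows by \<open>2 d\<close>. Linear
  arithmetic refutes each combination of the old and the new peak.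

  This is the effect on the circle of a move in CN(8,3) that lowers one of the two minima by \<open>d\<close>.
\<close>

lemma balanced_raise:
  assumes "balanced y0 y1 y2 y3 y4" "0 < d"
    and "z2 = y2 + d" "z1 = y1 + d \<and> z3 \<le> y3 + d \<or> z1 \<le> y1 + d \<and> z3 = y3 + d"
    and "z0 \<le> y0" "z4 \<le> y4"
  shows "\<not> balanced z0 z1 z2 z3 z4"
proof
  assume "balanced z0 z1 z2 z3 z4"
  with assms show False
    unfolding balanced_def peak_def
    by (elim disjE; elim conjE; linarith)
qed

section \<open>Anchored positions of CN(8,3)\<close>

lemma length_8_cases:
  assumes "length p = 8"
  obtains p0 p1 p2 p3 p4 p5 p6 p7 where "p = [p0, p1, p2, p3, p4, p5, p6, p7]"
proof -
  from assms have "\<exists>p0 p1 p2 p3 p4 p5 p6 p7. p = [p0, p1, p2, p3, p4, p5, p6, p7]"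
    by (auto simp: eval_nat_numeral length_Suc_conv)
  with that show thesis by blast
qed

lemma ex_rotate_8:
  "(\<exists>r. P (rotate r [p0, p1, p2, p3, p4, p5, p6, p7])) \<longleftrightarrow>
     P [p0, p1, p2, p3, p4, p5, p6, p7] \<or> P [p1, p2, p3, p4, p5, p6, p7, p0] \<or>
     P [p2, p3, p4, p5, p6, p7, p0, p1] \<or> P [p3, p4, p5, p6, p7, p0, p1, p2] \<or>
     P [p4, p5, p6, p7, p0, p1, p2, p3] \<or> P [p5, p6, p7, p0, p1, p2, p3, p4] \<or>
     P [p6, p7, p0, p1, p2, p3, p4, p5] \<or> P [p7, p0, p1, p2, p3, p4, p5, p6]"
  (is "(\<exists>r. P (rotate r ?p)) \<longleftrightarrow> ?R")
proof -
  have "(\<exists>r. P (rotate r ?p)) \<longleftrightarrow> (\<exists>r<8. P (rotate r ?p))"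
    by (rule ex_rotate_less) simp_all
  also have "\<dots> \<longleftrightarrow> ?R"
    unfolding ex_less_8 by (simp add: rotate_drop_take)
  finally show ?thesis .
qed

definition lowest :: "nat list \<Rightarrow> bool" where
  "lowest p \<longleftrightarrow> p ! 0 \<le> p ! 2 \<and> p ! 0 \<le> p ! 4 \<and> p ! 0 \<le> p ! 6 \<and>
     p ! 3 \<le> p ! 1 \<and> p ! 3 \<le> p ! 5 \<and> p ! 3 \<le> p ! 7"

text \<open>
  Stacks 5 and 6 form one heap: every window that meets both meets only one other heap, as any other
  window does at most two neighbouring heaps.
\<close>

definition anchored :: "nat list \<Rightarrow> bool" where
  "anchored p \<longleftrightarrow> length p = 8 \<and> lowest p \<and>
     balanced (p ! 1 - p ! 3) (p ! 2 - p ! 0) (p ! 4 - p ! 0)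
       ((p ! 5 - p ! 3) + (p ! 6 - p ! 0)) (p ! 7 - p ! 3)"

text \<open>
  Rotations suffice, since reflections are rotations followed by the reflection \<open>i \<mapsto> 3 - i\<close>,
  which preserves \<open>anchored\<close>.
\<close>

definition cold :: "nat list \<Rightarrow> bool" where
  "cold p \<longleftrightarrow> (\<exists>r. anchored (rotate r p))"

lemma anchoredE:
  assumes "anchored p"
  obtains a b x1 x2 x4 x5 x6 x7 where
    "p = [a, b + x1, a + x2, b, a + x4, b + x5, a + x6, b + x7]"
    "balanced x1 x2 x4 (x5 + x6) x7"
proof -
  obtain p0 p1 p2 p3 p4 p5 p6 p7 where p: "p = [p0, p1, p2, p3, p4, p5, p6, p7]"
    using assms by (auto simp: anchored_def elim: length_8_cases)
  have low: "p0 \<le> p2" "p0 \<le> p4" "p0 \<le> p6" "p3 \<le> p1" "p3 \<le> p5" "p3 \<le> p7"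
    using assms by (simp_all add: p anchored_def lowest_def)
  have bal: "balanced (p1 - p3) (p2 - p0) (p4 - p0) ((p5 - p3) + (p6 - p0)) (p7 - p3)"
    using assms by (simp add: p anchored_def)
  show thesis
    by (rule that[OF _ bal, of p0 p3]) (simp add: p low)
qed

lemma anchored_offsets:
  "anchored [a, b + x1, a + x2, b, a + x4, b + x5, a + x6, b + x7] \<longleftrightarrow>
     balanced x1 x2 x4 (x5 + x6) x7"
  by (simp add: anchored_def lowest_def)

text \<open>
  A second pair of lowest stacks at distance three leads to an equivalent condition. Either it gives
  the same cyclic sequence of heaps, or both circles contain an empty heap and \<open>balanced_zeros\<close>
  turns both conditions into the same equation.
\<close>

lemma cold_imp_balanced:
  assumes "cold [a, b + x1, a + x2, b, a + x4, b + x5, a + x6, b + x7]"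
  shows "balanced x1 x2 x4 (x5 + x6) x7"
proof -
  have turn: "balanced x4 x5 x7 x1 x2 \<longleftrightarrow> balanced x1 x2 x4 x5 x7"
    "balanced x6 x7 x1 x2 x4 \<longleftrightarrow> balanced x1 x2 x4 x6 x7"
    using balanced_rotate_iff by metis+
  from assms show ?thesis
    unfolding cold_def ex_rotate_8
    by (elim disjE) (auto simp: anchored_def lowest_def balanced_zeros turn)
qed

lemma cold_lowest_anchored:
  assumes "cold p" "length p = 8" "lowest p"
  shows "anchored p"
proof -
  obtain p0 p1 p2 p3 p4 p5 p6 p7 where p: "p = [p0, p1, p2, p3, p4, p5, p6, p7]"
    using assms(2) by (rule length_8_cases)
  have "p = [p0, p3 + (p1 - p3), p0 + (p2 - p0), p3, p0 + (p4 - p0), p3 + (p5 - p3),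
      p0 + (p6 - p0), p3 + (p7 - p3)]"
    using assms(3) by (simp add: p lowest_def)
  with assms(1) show ?thesis
    by (metis cold_imp_balanced anchored_offsets)
qed

lemma cold_rotate: "cold (rotate r p) \<longleftrightarrow> cold p"
proof
  assume "cold (rotate r p)"
  then show "cold p" by (auto simp: cold_def rotate_rotate)
next
  assume "cold p"
  then obtain s where s: "anchored (rotate s p)" by (auto simp: cold_def)
  then have "length p = 8" by (auto simp: anchored_def)
  then have "rotate s p = rotate (s + (8 - r mod 8)) (rotate r p)"
    using unrotate[of p 8 r] by (metis rotate_rotate zero_less_numeral)
  with s show "cold (rotate r p)" by (auto simp: cold_def)
qed

text \<open>
  Only the pairs \<open>(0, 3)\<close> and \<open>(3, 6)\<close> contain stack 3, so stack 0 or stack 6 has to be lowest in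
  its class. If the anchor contains neither of these, stack 3 is a heap of its own in the circle.
  This heap is empty, and balance then forces a second empty heap that makes stack 0 or stack 6 lowest.
\<close>

lemma cold_anchored_at_low:
  assumes cold: "cold [p0, p1, p2, p3, p4, p5, p6, p7]"
    and low: "p3 \<le> p1" "p3 \<le> p5" "p3 \<le> p7"
  shows "anchored [p0, p1, p2, p3, p4, p5, p6, p7] \<or>
    anchored [p3, p4, p5, p6, p7, p0, p1, p2]"
proof -
  have "p0 \<le> p2 \<and> p0 \<le> p4 \<and> p0 \<le> p6 \<or> p6 \<le> p0 \<and> p6 \<le> p2 \<and> p6 \<le> p4"
    using cold low unfolding cold_def ex_rotate_8
    by (elim disjE; elim anchoredE) (auto simp: balanced_zeros)
  moreover have "cold [p3, p4, p5, p6, p7, p0, p1, p2]"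
    using cold cold_rotate[of 3 "[p0, p1, p2, p3, p4, p5, p6, p7]"]
    by (simp add: rotate_drop_take)
  ultimately show ?thesis
    using cold low by (auto simp: lowest_def intro: cold_lowest_anchored)
qed

text \<open>
  The reflection \<open>i \<mapsto> 3 - i\<close> fixes the anchor and reflects the circle of five heaps.
\<close>

lemma anchored_mirror:
  assumes "anchored [p0, p1, p2, p3, p4, p5, p6, p7]"
  shows "anchored [p3, p2, p1, p0, p7, p6, p5, p4]"
proof -
  obtain a b x1 x2 x4 x5 x6 x7 where
    p: "[p0, p1, p2, p3, p4, p5, p6, p7] =
      [a, b + x1, a + x2, b, a + x4, b + x5, a + x6, b + x7]"
    and bal: "balanced x1 x2 x4 (x5 + x6) x7"
    using assms by (rule anchoredE)
  have "balanced x2 x1 x7 (x6 + x5) x4"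
    using balanced_rotate[OF balanced_rotate[OF balanced_rotate[OF balanced_reflect[OF bal]]]]
    by (simp add: add.commute)
  with p show ?thesis
    using anchored_offsets[of b a x2 x1 x7 x6 x5 x4] by simp
qed

lemma cold_rev:
  assumes "cold p"
  shows "cold (rev p)"
proof -
  obtain r where r: "anchored (rotate r p)"
    using assms by (auto simp: cold_def)
  then have len: "length (rotate r p) = 8" by (simp add: anchored_def)
  then obtain p0 p1 p2 p3 p4 p5 p6 p7 where p: "rotate r p = [p0, p1, p2, p3, p4, p5, p6, p7]"
    by (rule length_8_cases)
  have "rotate 4 (rev (rotate r p)) = [p3, p2, p1, p0, p7, p6, p5, p4]"
    unfolding p by (simp add: rotate_drop_take)
  then have "anchored (rotate 4 (rev (rotate r p)))"
    using anchored_mirror[OF r[unfolded p]] by simp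
  then have "cold (rev (rotate r p))"
    unfolding cold_def by blast
  then show ?thesis
    using len by (simp add: rev_rotate[of p 8] cold_rotate)
qed

lemma cold_mirror:
  assumes "cold [p0, p1, p2, p3, p4, p5, p6, p7]"
  shows "cold [p3, p2, p1, p0, p7, p6, p5, p4]"
  using cold_rev[OF assms] cold_rotate[of 4 "[p7, p6, p5, p4, p3, p2, p1, p0]"]
  by (simp add: rotate_drop_take)

section \<open>No move leads from a cold position to a cold position\<close>

lemma anchored_coordsE:
  assumes "anchored [p0, p1, p2, p3, p4, p5, p6, p7]"
  obtains a b x1 x2 x4 x5 x6 x7 where
    "p0 = a" "p1 = b + x1" "p2 = a + x2" "p3 = b"
    "p4 = a + x4" "p5 = b + x5" "p6 = a + x6" "p7 = b + x7"
    "balanced x1 x2 x4 (x5 + x6) x7"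
  using assms by (rule anchoredE) (rule that; simp)

text \<open>
  A move that lowers the minimum at stack 0 does not reach stack 3, because a window spans distance
  two. So stack 3 was lowest in its class before the move, and the old position is anchored at the
  pair \<open>(0, 3)\<close> or \<open>(3, 6)\<close>. In both cases the circle after the move arises as in
  \<open>balanced_raise\<close>, with the heap of stack 4 in the middle.
\<close>

lemma cold_no_new_minimum:
  assumes move: "cn_move 8 3 [p0, p1, p2, p3, p4, p5, p6, p7] [q0, q1, q2, q3, q4, q5, q6, q7]"
    and cold: "cold [p0, p1, p2, p3, p4, p5, p6, p7]"
    and anch: "anchored [q0, q1, q2, q3, q4, q5, q6, q7]"
  shows "min (min p0 p2) (min p4 p6) \<le> q0"
proof (rule ccontr)
  assume "\<not> ?thesis"
  then have drop: "q0 < p0" "q0 < p6" by simp_all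
  obtain a b y1 y2 y4 y5 y6 y7 where
    q: "q0 = a" "q1 = b + y1" "q2 = a + y2" "q3 = b" "q4 = a + y4" "q5 = b + y5" "q6 = a + y6"
      "q7 = b + y7"
    and bal: "balanced y1 y2 y4 (y5 + y6) y7"
    using anch by (rule anchored_coordsE)
  have le: "q0 \<le> p0" "q1 \<le> p1" "q2 \<le> p2" "q3 \<le> p3" "q4 \<le> p4" "q5 \<le> p5" "q6 \<le> p6" "q7 \<le> p7"
    using move unfolding cn_move_8_3 by blast+
  have win: "q3 = p3 \<and> q4 = p4 \<and> q5 = p5 \<and>
      (q6 = p6 \<and> q7 = p7 \<or> q1 = p1 \<and> q2 = p2 \<or> q2 = p2 \<and> q6 = p6)"
    using move drop(1) unfolding cn_move_8_3 by force
  have "p3 \<le> p1" "p3 \<le> p5" "p3 \<le> p7"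
    using win le q by linarith+
  with cold have "anchored [p0, p1, p2, p3, p4, p5, p6, p7] \<or>
      anchored [p3, p4, p5, p6, p7, p0, p1, p2]"
    by (rule cold_anchored_at_low)
  then show False
  proof
    assume "anchored [p0, p1, p2, p3, p4, p5, p6, p7]"
    then obtain a' b' x1 x2 x4 x5 x6 x7 where
      p: "p0 = a'" "p1 = b' + x1" "p2 = a' + x2" "p3 = b'" "p4 = a' + x4" "p5 = b' + x5"
        "p6 = a' + x6" "p7 = b' + x7"
      and bal': "balanced x1 x2 x4 (x5 + x6) x7"
      by (rule anchored_coordsE)
    obtain d where d: "a' = a + d" "0 < d"
      using drop(1) less_imp_add_positive[of a a'] unfolding q p by blast
    have "\<not> balanced y1 y2 y4 (y5 + y6) y7"
      by (rule balanced_raise[OF bal' d(2)]) (use win le in \<open>auto simp: q p d(1)\<close>)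
    with bal show False by contradiction
  next
    assume "anchored [p3, p4, p5, p6, p7, p0, p1, p2]"
    then obtain a' b' x1 x2 x4 x5 x6 x7 where
      p: "p3 = b'" "p4 = a' + x1" "p5 = b' + x2" "p6 = a'" "p7 = b' + x4" "p0 = a' + x5"
        "p1 = b' + x6" "p2 = a' + x7"
      and bal': "balanced x1 x2 x4 (x5 + x6) x7"
      by (rule anchored_coordsE)
    obtain d where d: "a' = a + d" "0 < d"
      using drop(2) less_imp_add_positive[of a a'] unfolding q p by blast
    have bal'': "balanced (x5 + x6) x7 x1 x2 x4"
      by (rule balanced_rotate[OF balanced_rotate[OF balanced_rotate[OF bal']]])
    have "\<not> balanced y1 y2 y4 (y5 + y6) y7"
      by (rule balanced_raise[OF bal'' d(2)]) (use win le in \<open>auto simp: q p d(1)\<close>)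
    with bal show False by contradiction
  qed
qed

text \<open>
  With both minima in place a move of CN(8,3) is a move of CN(5,2) on the circle.
\<close>

lemma anchored_same_minima:
  assumes move: "cn_move 8 3 [p0, p1, p2, p3, p4, p5, p6, p7] [p0, q1, q2, p3, q4, q5, q6, q7]"
    and p: "anchored [p0, p1, p2, p3, p4, p5, p6, p7]"
    and q: "anchored [p0, q1, q2, p3, q4, q5, q6, q7]"
  shows False
proof -
  obtain a b x1 x2 x4 x5 x6 x7 where
    p: "p0 = a" "p1 = b + x1" "p2 = a + x2" "p3 = b" "p4 = a + x4" "p5 = b + x5" "p6 = a + x6"
      "p7 = b + x7"
    and bal: "balanced x1 x2 x4 (x5 + x6) x7"
    using p by (rule anchored_coordsE)
  obtain a' b' y1 y2 y4 y5 y6 y7 where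
    q: "p0 = a'" "q1 = b' + y1" "q2 = a' + y2" "p3 = b'" "q4 = a' + y4" "q5 = b' + y5"
      "q6 = a' + y6" "q7 = b' + y7"
    and bal': "balanced y1 y2 y4 (y5 + y6) y7"
    using q by (rule anchored_coordsE)
  have ab: "a' = a" "b' = b" using p q by simp_all
  have less: "y1 + y2 + y4 + (y5 + y6) + y7 < x1 + x2 + x4 + (x5 + x6) + x7"
    using cn_move_sum_less[OF move] unfolding p(2,3,5-8) q(2,3,5-8) ab by (simp add: p)
  have "q1 \<le> p1 \<and> q2 \<le> p2 \<and> q4 \<le> p4 \<and> q5 \<le> p5 \<and> q6 \<le> p6 \<and> q7 \<le> p7"
    using move[unfolded cn_move_8_3, THEN conjunct2] by (elim conjE disjE; simp)
  then have le: "y1 \<le> x1 \<and> y2 \<le> x2 \<and> y4 \<le> x4 \<and> y5 \<le> x5 \<and> y6 \<le> x6 \<and> y7 \<le> x7"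
    unfolding p(2,3,5-8) q(2,3,5-8) ab add_le_cancel_left .
  have "q4 = p4 \<and> q5 = p5 \<and> q6 = p6 \<and> q7 = p7 \<or> q1 = p1 \<and> q5 = p5 \<and> q6 = p6 \<and> q7 = p7 \<or>
      q1 = p1 \<and> q2 = p2 \<and> q7 = p7 \<or> q1 = p1 \<and> q2 = p2 \<and> q4 = p4 \<or>
      q2 = p2 \<and> q4 = p4 \<and> q5 = p5 \<and> q6 = p6"
    using move[unfolded cn_move_8_3, THEN conjunct2] by (elim conjE disjE; simp)
  then have "y4 = x4 \<and> y5 = x5 \<and> y6 = x6 \<and> y7 = x7 \<or> y1 = x1 \<and> y5 = x5 \<and> y6 = x6 \<and> y7 = x7 \<or>
      y1 = x1 \<and> y2 = x2 \<and> y7 = x7 \<or> y1 = x1 \<and> y2 = x2 \<and> y4 = x4 \<or>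
      y2 = x2 \<and> y4 = x4 \<and> y5 = x5 \<and> y6 = x6"
    unfolding p(2,3,5-8) q(2,3,5-8) ab add_left_cancel .
  then have win: "y4 = x4 \<and> y5 + y6 = x5 + x6 \<and> y7 = x7 \<or>
      y1 = x1 \<and> y5 + y6 = x5 + x6 \<and> y7 = x7 \<or> y1 = x1 \<and> y2 = x2 \<and> y7 = x7 \<or>
      y1 = x1 \<and> y2 = x2 \<and> y4 = x4 \<or> y2 = x2 \<and> y4 = x4 \<and> y5 + y6 = x5 + x6"
    by (elim conjE disjE; simp)
  have "[y1, y2, y4, y5 + y6, y7] \<noteq> [x1, x2, x4, x5 + x6, x7]"
    using less by auto
  moreover have "y5 + y6 \<le> x5 + x6"
    using le by simp
  ultimately have "cn_move 5 2 [x1, x2, x4, x5 + x6, x7] [y1, y2, y4, y5 + y6, y7]"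
    using le win unfolding cn_move_5_2 by (elim conjE; intro conjI)
  then show False
    using balanced_stable[OF bal bal'] by contradiction
qed

lemma cold_stable:
  assumes "cold p" "cold q"
  shows "\<not> cn_move 8 3 p q"
proof
  assume mv: "cn_move 8 3 p q"
  obtain s where anch: "anchored (rotate s q)"
    using assms(2) by (auto simp: cold_def)
  define p' q' where "p' = rotate s p" and "q' = rotate s q"
  have move: "cn_move 8 3 p' q'" and cold: "cold p'" "cold q'" and anch: "anchored q'"
    using assms mv anch by (simp_all add: p'_def q'_def cn_move_rotate cold_rotate)
  have len: "length p' = 8" "length q' = 8"
    using move by (simp_all add: cn_move_def)
  obtain p0 p1 p2 p3 p4 p5 p6 p7 where p: "p' = [p0, p1, p2, p3, p4, p5, p6, p7]"
    using len(1) by (rule length_8_cases)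
  obtain q0 q1 q2 q3 q4 q5 q6 q7 where q: "q' = [q0, q1, q2, q3, q4, q5, q6, q7]"
    using len(2) by (rule length_8_cases)
  have even: "min (min p0 p2) (min p4 p6) \<le> q0"
    by (rule cold_no_new_minimum[OF move[unfolded p q] cold(1)[unfolded p] anch[unfolded q]])
  have "cn_move 8 3 [p3, p2, p1, p0, p7, p6, p5, p4] [q3, q2, q1, q0, q7, q6, q5, q4]"
    using move unfolding p q cn_move_8_3 by (elim conjE disjE) auto
  from cold_no_new_minimum[OF this cold_mirror[OF cold(1)[unfolded p]]
      anchored_mirror[OF anch[unfolded q]]]
  have odd: "min (min p3 p1) (min p7 p5) \<le> q3" .
  have le: "q0 \<le> p0" "q1 \<le> p1" "q2 \<le> p2" "q3 \<le> p3" "q4 \<le> p4" "q5 \<le> p5" "q6 \<le> p6" "q7 \<le> p7"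
    using move unfolding p q cn_move_8_3 by blast+
  have low: "q0 \<le> q2" "q0 \<le> q4" "q0 \<le> q6" "q3 \<le> q1" "q3 \<le> q5" "q3 \<le> q7"
    using anch by (simp_all add: q anchored_def lowest_def)
  obtain r where r: "r < 8" "anchored (rotate r p')"
    using cold(1) ex_rotate_less[OF len(1)] unfolding cold_def by auto
  have lowp: "lowest (rotate r p')"
    using r(2) by (simp add: anchored_def)
  consider "r = 0" | "r = 1" | "r = 2" | "r = 3" | "r = 4" | "r = 5" | "r = 6" | "r = 7"
    using r(1) by linarith
  (* No class has a new minimum, so each lowest stack of p' at the anchor r
     keeps its height and is lowest in q' as well. *)
  then have same: "lowest (rotate r q') \<and> rotate r q' ! 0 = rotate r p' ! 0 \<and>
      rotate r q' ! 3 = rotate r p' ! 3"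
    using lowp even odd
    by cases (simp add: p q rotate_drop_take lowest_def; use le low in linarith)+
  have move: "cn_move 8 3 (rotate r p') (rotate r q')"
    using move by (rule cn_move_rotate)
  have anch: "anchored (rotate r q')"
    using cold(2) len same by (intro cold_lowest_anchored) (simp_all add: cold_rotate)
  obtain u0 u1 u2 u3 u4 u5 u6 u7 where u: "rotate r p' = [u0, u1, u2, u3, u4, u5, u6, u7]"
    by (rule length_8_cases[of "rotate r p'"]) (simp_all add: len)
  obtain v0 v1 v2 v3 v4 v5 v6 v7 where v: "rotate r q' = [v0, v1, v2, v3, v4, v5, v6, v7]"
    by (rule length_8_cases[of "rotate r q'"]) (simp_all add: len)
  have "v0 = u0" "v3 = u3"
    using same by (simp_all add: u v)
  then show False
    using move anch r(2) anchored_same_minima unfolding u v by blast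
qed

section \<open>Every other position has a move to a cold position\<close>

text \<open>
  The winning move on the circle is carried out on the stacks above the two minima.
\<close>

lemma lowest_absorb:
  assumes hot: "\<not> cold p" and len: "length p = 8" and low: "lowest p"
  obtains q where "cold q" "cn_move 8 3 p q"
proof -
  obtain p0 p1 p2 p3 p4 p5 p6 p7 where p0: "p = [p0, p1, p2, p3, p4, p5, p6, p7]"
    using len by (rule length_8_cases)
  define x1 x2 x4 x5 x6 x7 where
    "x1 = p1 - p3" "x2 = p2 - p0" "x4 = p4 - p0" "x5 = p5 - p3" "x6 = p6 - p0" "x7 = p7 - p3"
  note x = this
  have p: "p = [p0, p3 + x1, p0 + x2, p3, p0 + x4, p3 + x5, p0 + x6, p3 + x7]"
    using low by (simp add: p0 x lowest_def)
  have "\<not> balanced x1 x2 x4 (x5 + x6) x7"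
  proof
    assume "balanced x1 x2 x4 (x5 + x6) x7"
    then have "anchored (rotate 0 p)" by (simp add: p anchored_offsets)
    with hot show False unfolding cold_def by blast
  qed
  then obtain z1 z2 z4 z z7 where bal: "balanced z1 z2 z4 z z7"
    and move: "cn_move 5 2 [x1, x2, x4, x5 + x6, x7] [z1, z2, z4, z, z7]"
    by (rule balanced_absorb)
  (* The new height z of the merged heap is split as z5 + z6 with z5 <= x5 and z6 <= x6;
     an unchanged heap must keep both parts. *)
  define z5 where "z5 = min x5 z"
  define z6 where "z6 = z - z5"
  have z: "z = z5 + z6" "z5 \<le> x5" by (simp_all add: z5_def z6_def)
  have le: "z1 \<le> x1" "z2 \<le> x2" "z4 \<le> x4" "z \<le> x5 + x6" "z7 \<le> x7"
    using move[unfolded cn_move_5_2, THEN conjunct2] by (simp_all only:)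
  have z6: "z6 \<le> x6" "z = x5 + x6 \<Longrightarrow> z5 = x5 \<and> z6 = x6"
    using le(4) by (simp_all add: z5_def z6_def)
  have ne: "[z1, z2, z4, z, z7] \<noteq> [x1, x2, x4, x5 + x6, x7]"
    using move[unfolded cn_move_5_2] by (rule conjunct1)
  have win: "z4 = x4 \<and> z = x5 + x6 \<and> z7 = x7 \<or> z1 = x1 \<and> z = x5 + x6 \<and> z7 = x7 \<or>
      z1 = x1 \<and> z2 = x2 \<and> z7 = x7 \<or> z1 = x1 \<and> z2 = x2 \<and> z4 = x4 \<or>
      z2 = x2 \<and> z4 = x4 \<and> z = x5 + x6"
    using move[unfolded cn_move_5_2] by (elim conjE)
  let ?q = "[p0, p3 + z1, p0 + z2, p3, p0 + z4, p3 + z5, p0 + z6, p3 + z7]"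
  have "anchored (rotate 0 ?q)"
    using bal by (simp add: anchored_offsets z(1))
  then have "cold ?q" unfolding cold_def by blast
  moreover have "?q \<noteq> p"
    using ne by (auto simp: p z(1))
  then have "cn_move 8 3 p ?q"
    using le z(2) z6 win unfolding p cn_move_8_3
    by (elim disjE) simp_all
  ultimately show thesis by (rule that)
qed

text \<open>
  Each target has a heap of height 0 in its circle, so by \<open>balanced_zeros\<close> it suffices to make one
  further heap empty and one heap equal to the sum of the other two. The targets are anchored at
  the pairs \<open>(0, 3)\<close> in cases 1 and 2, \<open>(6, 1)\<close> in cases 3 and 4, \<open>(1, 4)\<close> in case 5 and \<open>(5, 0)\<close>
  in case 6. The reflection \<open>i \<mapsto> 1 - i\<close> exchanges cases 1 and 2
  with cases 3 and 4.
\<close>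

lemma adjacent_absorb:
  assumes hot: "\<not> cold [a, b, a + x2, b + x3, a + x4, b + x5, a + x6, b + x7]"
  obtains q where "cold q" "cn_move 8 3 [a, b, a + x2, b + x3, a + x4, b + x5, a + x6, b + x7] q"
proof -
  let ?p = "[a, b, a + x2, b + x3, a + x4, b + x5, a + x6, b + x7]"
  have coldI: "cold q" if "anchored (rotate r q)" for r q
    using that unfolding cold_def by blast
  note move_to = that
  have result: thesis if "cold q" "q \<noteq> ?p \<Longrightarrow> cn_move 8 3 ?p q" for q
    using move_to[OF that(1)] that hot by blast
  consider "x6 + x7 \<le> x2" "x2 \<le> x5 + x6 + x7" | "x5 + x6 + x7 < x2"
    | "x2 + x3 \<le> x7" "x7 \<le> x2 + x3 + x4" | "x2 + x3 + x4 < x7"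
    | "x2 + x3 \<le> x6 + x7" "x7 < x2 + x3" | "x6 + x7 < x2 + x3" "x2 < x6 + x7"
    by linarith
  then show thesis
  proof cases
    case 1
    let ?q = "[a, b, a + x2, b, a, b + (x2 - x6 - x7), a + x6, b + x7]"
    show thesis
    proof (rule result)
      show "cold ?q"
        using 1 by (intro coldI[of 0]) (simp add: anchored_def lowest_def balanced_zeros)
      show "cn_move 8 3 ?p ?q" if "?q \<noteq> ?p"
        using that 1 unfolding cn_move_8_3 by simp
    qed
  next
    case 2
    let ?q = "[a, b, a + (x5 + x6 + x7), b, a, b + x5, a + x6, b + x7]"
    show thesis
    proof (rule result)
      show "cold ?q"
        using 2 by (intro coldI[of 0]) (simp add: anchored_def lowest_def balanced_zeros)
      show "cn_move 8 3 ?p ?q" if "?q \<noteq> ?p"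
        using that 2 unfolding cn_move_8_3 by simp
    qed
  next
    case 3
    let ?q = "[a, b, a + x2, b + x3, a + (x7 - x2 - x3), b, a, b + x7]"
    show thesis
    proof (rule result)
      show "cold ?q"
        using 3 by (intro coldI[of 6]) (simp add: rotate_drop_take anchored_def lowest_def balanced_zeros)
      show "cn_move 8 3 ?p ?q" if "?q \<noteq> ?p"
        using that 3 unfolding cn_move_8_3 by simp
    qed
  next
    case 4
    let ?q = "[a, b, a + x2, b + x3, a + x4, b, a, b + (x2 + x3 + x4)]"
    show thesis
    proof (rule result)
      show "cold ?q"
        using 4 by (intro coldI[of 6]) (simp add: rotate_drop_take anchored_def lowest_def balanced_zeros)
      show "cn_move 8 3 ?p ?q" if "?q \<noteq> ?p"
        using that 4 unfolding cn_move_8_3 by simp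
    qed
  next
    case 5
    let ?q = "[a, b, a + x2, b + x3, a, b, a + (x2 + x3 - x7), b + x7]"
    show thesis
    proof (rule result)
      show "cold ?q"
        using 5 by (intro coldI[of 1]) (simp add: rotate_drop_take anchored_def lowest_def balanced_zeros)
      show "cn_move 8 3 ?p ?q" if "?q \<noteq> ?p"
        using that 5 unfolding cn_move_8_3 by simp
    qed
  next
    case 6
    let ?q = "[a, b, a + x2, b + (x6 + x7 - x2), a, b, a + x6, b + x7]"
    show thesis
    proof (rule result)
      show "cold ?q"
        using 6 by (intro coldI[of 5]) (simp add: rotate_drop_take anchored_def lowest_def balanced_zeros)
      show "cn_move 8 3 ?p ?q" if "?q \<noteq> ?p"
        using that 6 unfolding cn_move_8_3 by simp
    qed
  qed
qed

definition adjacent_minima :: "nat list \<Rightarrow> bool" where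
  "adjacent_minima p \<longleftrightarrow> p ! 0 \<le> p ! 2 \<and> p ! 0 \<le> p ! 4 \<and> p ! 0 \<le> p ! 6 \<and>
     p ! 1 \<le> p ! 3 \<and> p ! 1 \<le> p ! 5 \<and> p ! 1 \<le> p ! 7"

text \<open>
  Stacks of different parity are at distance one or three. Rotating the appropriate one of the two
  to index 0 gives one of the two forms.
\<close>

lemma minima_cases:
  assumes "length p = 8"
  obtains r where "lowest (rotate r p)" | r where "adjacent_minima (rotate r p)"
proof -
  obtain p0 p1 p2 p3 p4 p5 p6 p7 where p: "p = [p0, p1, p2, p3, p4, p5, p6, p7]"
    using assms by (rule length_8_cases)
  have even: "p0 \<le> p2 \<and> p0 \<le> p4 \<and> p0 \<le> p6 \<or> p2 \<le> p0 \<and> p2 \<le> p4 \<and> p2 \<le> p6 \<or>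
      p4 \<le> p0 \<and> p4 \<le> p2 \<and> p4 \<le> p6 \<or> p6 \<le> p0 \<and> p6 \<le> p2 \<and> p6 \<le> p4"
    by linarith
  have odd: "p1 \<le> p3 \<and> p1 \<le> p5 \<and> p1 \<le> p7 \<or> p3 \<le> p1 \<and> p3 \<le> p5 \<and> p3 \<le> p7 \<or>
      p5 \<le> p1 \<and> p5 \<le> p3 \<and> p5 \<le> p7 \<or> p7 \<le> p1 \<and> p7 \<le> p3 \<and> p7 \<le> p5"
    by linarith
  have "\<exists>r. lowest (rotate r p) \<or> adjacent_minima (rotate r p)"
    using even odd unfolding p ex_rotate_8[of "\<lambda>l. lowest l \<or> adjacent_minima l"]
    by (elim disjE; simp add: lowest_def adjacent_minima_def)
  with that show thesis by blast
qed

lemma cold_absorb: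
  assumes hot: "\<not> cold p" and len: "length p = 8"
  obtains q where "cold q" "cn_move 8 3 p q"
proof -
  have "\<exists>r q. cold q \<and> cn_move 8 3 (rotate r p) q"
    using len
  proof (cases rule: minima_cases)
    case (1 r)
    with hot len show ?thesis
      by (metis lowest_absorb cold_rotate length_rotate)
  next
    case (2 r)
    have "length (rotate r p) = 8" using len by simp
    then obtain p0 p1 p2 p3 p4 p5 p6 p7 where p: "rotate r p = [p0, p1, p2, p3, p4, p5, p6, p7]"
      by (rule length_8_cases)
    have "rotate r p = [p0, p1, p0 + (p2 - p0), p1 + (p3 - p1), p0 + (p4 - p0), p1 + (p5 - p1),
        p0 + (p6 - p0), p1 + (p7 - p1)]"
      using 2 by (simp add: p adjacent_minima_def)
    with hot show ?thesis
      by (metis adjacent_absorb cold_rotate)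
  qed
  then obtain r q where q: "cold q" "cn_move 8 3 (rotate r p) q" by blast
  show thesis
  proof (rule that)
    show "cold (rotate (8 - r mod 8) q)"
      using q(1) by (simp add: cold_rotate)
    show "cn_move 8 3 p (rotate (8 - r mod 8) q)"
      using cn_move_rotate[OF q(2)] unrotate[OF len] by (metis zero_less_numeral)
  qed
qed

section \<open>The P-positions of CN(8,3)\<close>

lemma P83_imp_anchored:
  assumes "p \<in> P83"
  shows "anchored p"
proof -
  obtain a b x1 x2 x3 x4 x5 x6 x7 where
    p: "p = [a, b + x1, a + x2, b + x3, a + x4, b + x5, a + x6, b + x7]" "x3 = 0"
    and bal: "[x1, x2, x4, x5 + x6, x7] \<in> P_positions 5 2"
    using assms unfolding P83_def by blast
  from bal show ?thesis
    by (simp add: p anchored_offsets P_positions_5_2)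
qed

text \<open>
  Besides balance, membership in \<open>P83\<close> asks for the order of the two minima; when they are in the
  wrong order, \<open>anchored_mirror\<close> supplies the reflected position.
\<close>

lemma anchored_imp_P83:
  assumes "anchored p" "p ! 0 \<le> p ! 3"
  shows "p \<in> P83"
proof -
  obtain a b x1 x2 x4 x5 x6 x7 where
    p: "p = [a, b + x1, a + x2, b, a + x4, b + x5, a + x6, b + x7]"
    and bal: "balanced x1 x2 x4 (x5 + x6) x7"
    using assms(1) by (rule anchoredE)
  have "a = Min {p ! 0, p ! 2, p ! 4, p ! 6}" "b = Min {p ! 1, p ! 3, p ! 5, p ! 7}"
    by (simp_all add: p)
  moreover have "a \<le> b" using assms(2) by (simp add: p)
  moreover have "p = [a, b + x1, a + x2, b + 0, a + x4, b + x5, a + x6, b + x7]"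
    by (simp add: p)
  moreover have "[x1, x2, x4, x5 + x6, x7] \<in> P_positions 5 2"
    using bal by (simp add: P_positions_5_2)
  ultimately show ?thesis
    unfolding P83_def by blast
qed

lemma cold_iff_dihedral_P83: "cold p \<longleftrightarrow> (\<exists>q \<in> dihedral_images p. q \<in> P83)"
proof
  assume "\<exists>q \<in> dihedral_images p. q \<in> P83"
  then obtain r where "anchored (rotate r p) \<or> anchored (rotate r (rev p))"
    unfolding dihedral_images_def using P83_imp_anchored by blast
  then have "cold p \<or> cold (rev p)"
    unfolding cold_def by blast
  then show "cold p"
    using cold_rev[of "rev p"] by auto
next
  assume "cold p"
  then obtain r where anch: "anchored (rotate r p)"
    by (auto simp: cold_def)
  show "\<exists>q \<in> dihedral_images p. q \<in> P83"
  proof (cases "rotate r p ! 0 \<le> rotate r p ! 3")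
    case True
    with anch have "rotate r p \<in> P83" by (rule anchored_imp_P83)
    then show ?thesis unfolding dihedral_images_def by blast
  next
    case False
    have len: "length (rotate r p) = 8" using anch by (simp add: anchored_def)
    then obtain p0 p1 p2 p3 p4 p5 p6 p7 where p: "rotate r p = [p0, p1, p2, p3, p4, p5, p6, p7]"
      by (rule length_8_cases)
    have "[p3, p2, p1, p0, p7, p6, p5, p4] \<in> P83"
      using anchored_mirror[OF anch[unfolded p]] False by (intro anchored_imp_P83) (simp_all add: p)
    moreover have "[p3, p2, p1, p0, p7, p6, p5, p4] = rotate 4 (rev (rotate r p))"
      unfolding p by (simp add: rotate_drop_take)
    moreover have "rotate 4 (rev (rotate r p)) = rotate (4 + (8 - r mod 8)) (rev p)"
      using len by (simp add: rev_rotate[of p 8] rotate_rotate)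
    ultimately show ?thesis unfolding dihedral_images_def by auto
  qed
qed

theorem theorem6p3:
  "P_positions 8 3 = {p. \<exists>q \<in> dihedral_images p. q \<in> P83}"
proof -
  have len: "length p = 8" if "cold p" for p
    using that by (auto simp: cold_def anchored_def)
  have "P_positions 8 3 = {p. cold p}"
    using len cold_stable cold_absorb by (intro P_positions_eqI) (blast+)
  then show ?thesis
    by (simp add: cold_iff_dihedral_P83)
qed

end
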